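(* Assume $S(a_i,b_i)\ne\emptyset$ for every $i\in I$. Then $S(A,b)=\bigcup_{e\in E}[\underline{X}(e),\overline{X}]$.
   Context: Let $I=\{1,\dots,m\}$ and $J=\{1,\dots,n\}$ with $m,n\ge 1$. Let $A=(a_{ij})_{m\times n}$ be a matrix with entries in $[0,1]$ with $i$-th row $a_i$, and let $b=(b_i)_{m\times 1}$ be a vector with entries in $[0,1]$. Let $w\in(0,1)$ and $p>0$ be real numbers. For $x,y\in[0,1]$ put $\varphi(x,y)=\left(w x^{p}+(1-w)y^{p}\right)^{1/p}$ (weighted power mean). For $x\in[0,1]^n$ put $\varphi(a_i,x)=\max_{j\in J}\varphi(a_{ij},x_j)$, let $S(a_i,b_i)=\{x\in[0,1]^n:\varphi(a_i,x)=b_i\}$ and $S(A,b)=\bigcap_{i\in I}S(a_i,b_i)$. For $i\in I$ define $J^{-}(i)=\{j\in J: a_{ij}>b_i/\sqrt[p]{w}\}$, $J^{\infty}(i)=\{j\in J: b_i^{p}\ge 1-w,\ a_{ij}<[(b_i^{p}+w-1)/w]^{1/p}\}$ and $J(i)=J\setminus(J^{-}(i)\cup J^{\infty}(i))$. When $S(a_i,b_i)\neq\emptyset$ (in which case $J^{-}(i)=\emptyset$), define $\overline{X}(i)\in[0,1]^n$ by $\overline{X}(i)_j=\left(\frac{b_i^{p}-w a_{ij}^{p}}{1-w}\right)^{1/p}$ if $j\in J(i)$ and $\overline{X}(i)_j=1$ if $j\in J^{\infty}(i)$; and for each $j\in J(i)$ define $\underline{X}(i,j)\in[0,1]^n$ by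 $\underline{X}(i,j)_k=\left(\frac{b_i^{p}-w a_{ij}^{p}}{1-w}\right)^{1/p}$ if $k=j$ and $\underline{X}(i,j)_k=0$ otherwise. Let $\overline{X}=\min_{i\in I}\overline{X}(i)$ (componentwise minimum). Let $E$ be the set of all functions $e:I\to\bigcup_{i\in I}J(i)$ with $e(i)\in J(i)$ for all $i\in I$; for $e\in E$ let $\underline{X}(e)\in[0,1]^n$ be given by $\underline{X}(e)_j=\max_{i\in I}\underline{X}(i,e(i))_j$ for $j\in J$. For vectors $u,v\in[0,1]^n$, $[u,v]=\{x\in[0,1]^n: u_j\le x_j\le v_j\ \forall j\in J\}$ (which is empty if $u\not\le v$). *)

theory Defs
  imports "HOL-Analysis.Analysis"
begin

text \<open>
  The index sets $I$ and $J$ are the finite (hence nonempty) types \<open>'m\<close> and \<open>'n\<close>; the row $a_i$ of the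
  matrix is \<open>A $ i\<close>.  Real powers and roots are written with \<open>powr\<close>; they are only relevant for
  nonnegative bases, and \<open>0 powr q = 0\<close> agrees with the usual convention for \<open>q > 0\<close>.
\<close>

definition unit_cube :: "(real ^ 'n) set" where
  "unit_cube = {x. \<forall>j. 0 \<le> x $ j \<and> x $ j \<le> 1}"

definition power_mean :: "real \<Rightarrow> real \<Rightarrow> real \<Rightarrow> real \<Rightarrow> real" where
  "power_mean w p x y = (w * x powr p + (1 - w) * y powr p) powr (1 / p)"

definition max_power_mean :: "real \<Rightarrow> real \<Rightarrow> real ^ 'n \<Rightarrow> real ^ 'n \<Rightarrow> real" where
  "max_power_mean w p a x = Max (range (\<lambda>j. power_mean w p (a $ j) (x $ j)))"

definition row_solutions :: "real \<Rightarrow> real \<Rightarrow> real ^ 'n \<Rightarrow> real \<Rightarrow> (real ^ 'n) set" where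
  "row_solutions w p a \<beta> = {x \<in> unit_cube. max_power_mean w p a x = \<beta>}"

definition solutions :: "real \<Rightarrow> real \<Rightarrow> real ^ 'n ^ 'm \<Rightarrow> real ^ 'm \<Rightarrow> (real ^ 'n) set" where
  "solutions w p A b = (\<Inter>i. row_solutions w p (A $ i) (b $ i))"

definition J_minus :: "real \<Rightarrow> real \<Rightarrow> real ^ 'n ^ 'm \<Rightarrow> real ^ 'm \<Rightarrow> 'm \<Rightarrow> 'n set" where
  "J_minus w p A b i = {j. A $ i $ j > b $ i / w powr (1 / p)}"

definition J_infty :: "real \<Rightarrow> real \<Rightarrow> real ^ 'n ^ 'm \<Rightarrow> real ^ 'm \<Rightarrow> 'm \<Rightarrow> 'n set" where
  "J_infty w p A b i =
    {j. (b $ i) powr p \<ge> 1 - w \<and> A $ i $ j < (((b $ i) powr p + w - 1) / w) powr (1 / p)}"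

definition J_set :: "real \<Rightarrow> real \<Rightarrow> real ^ 'n ^ 'm \<Rightarrow> real ^ 'm \<Rightarrow> 'm \<Rightarrow> 'n set" where
  "J_set w p A b i = UNIV - (J_minus w p A b i \<union> J_infty w p A b i)"

definition crit_value :: "real \<Rightarrow> real \<Rightarrow> real ^ 'n ^ 'm \<Rightarrow> real ^ 'm \<Rightarrow> 'm \<Rightarrow> 'n \<Rightarrow> real" where
  "crit_value w p A b i j =
    (((b $ i) powr p - w * (A $ i $ j) powr p) / (1 - w)) powr (1 / p)"

text \<open>
  \<open>X_upper_row\<close> is meaningful only if the \<open>i\<close>-th equation is solvable.  Then \<open>J_minus\<close> is empty,
  so the \<open>else\<close> branch is exactly the case \<open>j \<in> J_infty w p A b i\<close>.
\<close>

definition X_upper_row :: "real \<Rightarrow> real \<Rightarrow> real ^ 'n ^ 'm \<Rightarrow> real ^ 'm \<Rightarrow> 'm \<Rightarrow> real ^ 'n" where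
  "X_upper_row w p A b i =
    (\<chi> j. if j \<in> J_set w p A b i then crit_value w p A b i j else 1)"

definition X_lower_row :: "real \<Rightarrow> real \<Rightarrow> real ^ 'n ^ 'm \<Rightarrow> real ^ 'm \<Rightarrow> 'm \<Rightarrow> 'n \<Rightarrow> real ^ 'n" where
  "X_lower_row w p A b i j = (\<chi> k. if k = j then crit_value w p A b i k else 0)"

definition X_upper :: "real \<Rightarrow> real \<Rightarrow> real ^ 'n ^ 'm \<Rightarrow> real ^ 'm \<Rightarrow> real ^ 'n" where
  "X_upper w p A b = (\<chi> j. Min (range (\<lambda>i. X_upper_row w p A b i $ j)))"

definition selections :: "real \<Rightarrow> real \<Rightarrow> real ^ 'n ^ 'm \<Rightarrow> real ^ 'm \<Rightarrow> ('m \<Rightarrow> 'n) set" where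
  "selections w p A b = {e. \<forall>i. e i \<in> J_set w p A b i}"

definition X_lower :: "real \<Rightarrow> real \<Rightarrow> real ^ 'n ^ 'm \<Rightarrow> real ^ 'm \<Rightarrow> ('m \<Rightarrow> 'n) \<Rightarrow> real ^ 'n" where
  "X_lower w p A b e = (\<chi> j. Max (range (\<lambda>i. X_lower_row w p A b i (e i) $ j)))"

definition box_interval :: "real ^ 'n \<Rightarrow> real ^ 'n \<Rightarrow> (real ^ 'n) set" where
  "box_interval u v = {x \<in> unit_cube. \<forall>j. u $ j \<le> x $ j \<and> x $ j \<le> v $ j}"

end

theory Submission
  imports Defs
begin

text \<open>
  The mean \<open>power_mean w p a\<close> is increasing in its last argument, so along \<open>[0,1]\<close> its values sweep
  the interval from \<open>power_mean w p a 0\<close> to \<open>power_mean w p a 1\<close>.  The index sets record where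
  \<open>b $ i\<close> lies relative to it: below for \<open>J_minus\<close>, above for \<open>J_infty\<close>, inside for \<open>J_set\<close>; in the
  last case \<open>crit_value\<close> is the unique argument at which \<open>b $ i\<close> is attained.  All these comparisons
  become linear in the \<open>p\<close>-th powers of the entries once the outer root is removed.

  A maximum equals \<open>b $ i\<close> iff all its terms are at most \<open>b $ i\<close> and some term is at least
  \<open>b $ i\<close>.  For a solvable row no index lies in \<open>J_minus\<close>, so the first condition is the upper bound
  \<open>x \<le> X_upper_row\<close> (lemma \<open>power_mean_le_iff_le_upper\<close>), and the second says that
  \<open>crit_value \<le> x $ j\<close> for some \<open>j\<close> in \<open>J_set\<close> (lemma \<open>power_mean_ge_iff_crit_le\<close>).  Over all rows,
  the upper bounds combine to \<open>x \<le> X_upper\<close>, while choosing one witness \<open>j\<close> for each row amounts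
  to a selection \<open>e\<close> with \<open>X_lower e \<le> x\<close>; the free choice of witnesses is the union over \<open>e\<close>.
\<close>

lemma powr_inverse_le_iff:
  fixes p u v :: real
  assumes "0 < p" "0 \<le> u" "0 \<le> v"
  shows "u powr (1 / p) \<le> v \<longleftrightarrow> u \<le> v powr p"
proof -
  have u: "(u powr (1 / p)) powr p = u"
    using assms by (simp add: powr_powr)
  show ?thesis
    using powr_mono2[of p "u powr (1 / p)" v] powr_less_mono2[of p v "u powr (1 / p)"] assms u
    by (auto simp: not_le[symmetric])
qed

lemma le_powr_inverse_iff:
  fixes p u v :: real
  assumes "0 < p" "0 \<le> u" "0 \<le> v"
  shows "v \<le> u powr (1 / p) \<longleftrightarrow> v powr p \<le> u"
proof -
  have u: "(u powr (1 / p)) powr p = u"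
    using assms by (simp add: powr_powr)
  show ?thesis
    using powr_mono2[of p v "u powr (1 / p)"] powr_less_mono2[of p "u powr (1 / p)" v] assms u
    by (auto simp: not_le[symmetric])
qed

lemma power_mean_le_iff:
  assumes "0 < w" "w < 1" "0 < p" "0 \<le> \<beta>"
  shows "power_mean w p a x \<le> \<beta> \<longleftrightarrow> w * a powr p + (1 - w) * x powr p \<le> \<beta> powr p"
  unfolding power_mean_def using assms by (intro powr_inverse_le_iff) auto

lemma power_mean_ge_iff:
  assumes "0 < w" "w < 1" "0 < p" "0 \<le> \<beta>"
  shows "\<beta> \<le> power_mean w p a x \<longleftrightarrow> \<beta> powr p \<le> w * a powr p + (1 - w) * x powr p"
  unfolding power_mean_def using assms by (intro le_powr_inverse_iff) auto

lemma max_power_mean_eq_iff: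
  "max_power_mean w p a x = \<beta> \<longleftrightarrow>
    (\<forall>j. power_mean w p (a $ j) (x $ j) \<le> \<beta>) \<and> (\<exists>j. \<beta> \<le> power_mean w p (a $ j) (x $ j))"
  unfolding max_power_mean_def
  by (subst Max_eq_iff) (auto intro: antisym)

text \<open>
  The right-hand side is \<open>power_mean w p (A $ i $ j) 0 > b $ i\<close> with the outer root removed.
\<close>

lemma J_minus_iff:
  assumes "0 \<le> A $ i $ j" "0 \<le> b $ i" "0 < w" "0 < p"
  shows "j \<in> J_minus w p A b i \<longleftrightarrow> (b $ i) powr p < w * (A $ i $ j) powr p"
proof -
  have root: "b $ i / w powr (1 / p) = ((b $ i) powr p / w) powr (1 / p)"
    using assms by (simp add: powr_divide powr_powr)
  have "A $ i $ j \<le> b $ i / w powr (1 / p) \<longleftrightarrow> (A $ i $ j) powr p \<le> (b $ i) powr p / w"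
    unfolding root using assms by (intro le_powr_inverse_iff) auto
  then show ?thesis
    using assms by (auto simp: J_minus_def not_le[symmetric] field_simps)
qed

text \<open>
  The right-hand side is \<open>power_mean w p (A $ i $ j) 1 < b $ i\<close> with the outer root removed.  It
  forces \<open>1 - w \<le> (b $ i) powr p\<close>, which is what makes the root in \<open>J_infty\<close> one of a nonnegative
  number.
\<close>

lemma J_infty_iff:
  assumes "0 \<le> A $ i $ j" "0 < w" "0 < p"
  shows "j \<in> J_infty w p A b i \<longleftrightarrow> w * (A $ i $ j) powr p + (1 - w) < (b $ i) powr p"
proof (cases "1 - w \<le> (b $ i) powr p")
  case True
  have "((b $ i powr p + w - 1) / w) powr (1 / p) \<le> A $ i $ j
      \<longleftrightarrow> (b $ i powr p + w - 1) / w \<le> (A $ i $ j) powr p"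
    using assms True by (intro powr_inverse_le_iff) auto
  with True show ?thesis
    using assms by (auto simp: J_infty_def not_le[symmetric] field_simps)
next
  case False
  moreover have "0 \<le> w * (A $ i $ j) powr p"
    using assms by simp
  ultimately show ?thesis
    by (auto simp: J_infty_def)
qed

lemma crit_value_le_iff:
  assumes "w * (A $ i $ j) powr p \<le> (b $ i) powr p" "w < 1" "0 < p" "0 \<le> t"
  shows "crit_value w p A b i j \<le> t
    \<longleftrightarrow> (b $ i) powr p \<le> w * (A $ i $ j) powr p + (1 - w) * t powr p"
  unfolding crit_value_def using assms
  by (subst powr_inverse_le_iff) (auto simp: field_simps)

lemma le_crit_value_iff:
  assumes "w * (A $ i $ j) powr p \<le> (b $ i) powr p" "w < 1" "0 < p" "0 \<le> t"
  shows "t \<le> crit_value w p A b i j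
    \<longleftrightarrow> w * (A $ i $ j) powr p + (1 - w) * t powr p \<le> (b $ i) powr p"
  unfolding crit_value_def using assms
  by (subst le_powr_inverse_iff) (auto simp: field_simps)

text \<open>
  An index in \<open>J_minus\<close> would push the maximum above \<open>b $ i\<close> for every nonnegative \<open>x\<close>, since the
  term in \<open>x\<close> can only increase the mean.
\<close>

lemma J_minus_empty:
  fixes A :: "real ^ 'n ^ 'm" and b :: "real ^ 'm"
  assumes "\<And>j. 0 \<le> A $ i $ j" "0 \<le> b $ i" "0 < w" "w < 1" "0 < p"
    and "row_solutions w p (A $ i) (b $ i) \<noteq> {}"
  shows "J_minus w p A b i = {}"
proof -
  from assms(6) obtain x where x: "max_power_mean w p (A $ i) x = b $ i"
    unfolding row_solutions_def by auto
  have "w * (A $ i $ j) powr p \<le> (b $ i) powr p" for j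
  proof -
    have "w * (A $ i $ j) powr p + (1 - w) * (x $ j) powr p \<le> (b $ i) powr p"
      using x assms(2-5) by (auto simp: max_power_mean_eq_iff power_mean_le_iff)
    moreover have "0 \<le> (1 - w) * (x $ j) powr p"
      using assms(4) by simp
    ultimately show ?thesis by linarith
  qed
  then show ?thesis
    using assms(1-5) by (auto simp: J_minus_iff not_less[symmetric])
qed

text \<open>
  Inside \<open>J_set\<close> the bound is inversion of the mean; on \<open>J_infty\<close> even the argument \<open>1\<close> keeps the
  mean below \<open>b $ i\<close>, so there the only restriction is that of the unit interval.
\<close>

lemma power_mean_le_iff_le_upper:
  fixes A :: "real ^ 'n ^ 'm" and b :: "real ^ 'm"
  assumes "0 \<le> A $ i $ j" "0 \<le> b $ i" "0 < w" "w < 1" "0 < p"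
    and "J_minus w p A b i = {}" "0 \<le> t" "t \<le> 1"
  shows "power_mean w p (A $ i $ j) t \<le> b $ i \<longleftrightarrow> t \<le> X_upper_row w p A b i $ j"
proof -
  have low: "w * (A $ i $ j) powr p \<le> (b $ i) powr p"
    using assms J_minus_iff[of A i j b w p] by auto
  show ?thesis
  proof (cases "j \<in> J_infty w p A b i")
    case True
    have "(1 - w) * t powr p \<le> (1 - w) * 1"
      using assms by (intro mult_left_mono powr_le1) auto
    moreover have "w * (A $ i $ j) powr p + (1 - w) < (b $ i) powr p"
      using True assms by (simp add: J_infty_iff)
    ultimately have "w * (A $ i $ j) powr p + (1 - w) * t powr p < (b $ i) powr p"
      using le_less_trans[OF add_left_mono] by fastforce
    with True assms show ?thesis
      by (simp add: power_mean_le_iff X_upper_row_def J_set_def)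
  next
    case False
    with assms low show ?thesis
      by (simp add: power_mean_le_iff X_upper_row_def J_set_def le_crit_value_iff)
  qed
qed

text \<open>
  Only indices in \<open>J_set\<close> can attain \<open>b $ i\<close>, because on \<open>J_infty\<close> the mean stays strictly below it.
\<close>

lemma power_mean_ge_iff_crit_le:
  fixes A :: "real ^ 'n ^ 'm" and b :: "real ^ 'm"
  assumes "0 \<le> A $ i $ j" "0 \<le> b $ i" "0 < w" "w < 1" "0 < p"
    and "J_minus w p A b i = {}" "0 \<le> t" "t \<le> 1"
  shows "b $ i \<le> power_mean w p (A $ i $ j) t
    \<longleftrightarrow> j \<in> J_set w p A b i \<and> crit_value w p A b i j \<le> t"
proof -
  have low: "w * (A $ i $ j) powr p \<le> (b $ i) powr p"
    using assms J_minus_iff[of A i j b w p] by auto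
  show ?thesis
  proof (cases "j \<in> J_infty w p A b i")
    case True
    have "(1 - w) * t powr p \<le> (1 - w) * 1"
      using assms by (intro mult_left_mono powr_le1) auto
    moreover have "w * (A $ i $ j) powr p + (1 - w) < (b $ i) powr p"
      using True assms by (simp add: J_infty_iff)
    ultimately have "w * (A $ i $ j) powr p + (1 - w) * t powr p < (b $ i) powr p"
      using le_less_trans[OF add_left_mono] by fastforce
    with True assms show ?thesis
      by (simp add: power_mean_ge_iff J_set_def)
  next
    case False
    with assms low show ?thesis
      by (simp add: power_mean_ge_iff J_set_def crit_value_le_iff)
  qed
qed

lemma le_X_upper_iff:
  "t \<le> X_upper w p A b $ j \<longleftrightarrow> (\<forall>i. t \<le> X_upper_row w p A b i $ j)"
  unfolding X_upper_def by auto

text \<open>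
  The vector \<open>X_lower_row i (e i)\<close> is zero off the coordinate \<open>e i\<close>, so on nonnegative vectors each
  row imposes just one inequality.
\<close>

lemma X_lower_le_iff:
  fixes A :: "real ^ 'n ^ 'm" and b :: "real ^ 'm" and x :: "real ^ 'n"
  assumes "\<And>j. 0 \<le> x $ j"
  shows "(\<forall>j. X_lower w p A b e $ j \<le> x $ j) \<longleftrightarrow> (\<forall>i. crit_value w p A b i (e i) \<le> x $ e i)"
proof -
  have "X_lower w p A b e $ j \<le> x $ j \<longleftrightarrow>
      (\<forall>i. (if j = e i then crit_value w p A b i j else 0) \<le> x $ j)" for j
    unfolding X_lower_def X_lower_row_def vec_lambda_beta
    by (subst Max_le_iff) (auto simp only: finite_imageI finite image_is_empty UNIV_not_empty
        ball_simps UNIV_I)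
  then show ?thesis
    using assms by auto
qed

theorem theorem5:
  fixes A :: "real ^ 'n ^ 'm" and b :: "real ^ 'm" and w p :: real
  assumes A: "\<And>i j. 0 \<le> A $ i $ j \<and> A $ i $ j \<le> 1"
    and b: "\<And>i. 0 \<le> b $ i \<and> b $ i \<le> 1"
    and w: "0 < w" "w < 1"
    and p: "0 < p"
    and solvable: "\<And>i. row_solutions w p (A $ i) (b $ i) \<noteq> {}"
  shows "solutions w p A b =
    (\<Union>e\<in>selections w p A b. box_interval (X_lower w p A b e) (X_upper w p A b))"
proof (rule set_eqI)
  fix x :: "real ^ 'n"
  have empty: "J_minus w p A b i = {}" for i
    using A b w p solvable by (intro J_minus_empty) auto
  show "x \<in> solutions w p A b \<longleftrightarrow>
    x \<in> (\<Union>e\<in>selections w p A b. box_interval (X_lower w p A b e) (X_upper w p A b))"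
  proof (cases "x \<in> unit_cube")
    case False
    then show ?thesis
      by (auto simp: solutions_def row_solutions_def box_interval_def)
  next
    case True
    then have x: "0 \<le> x $ j" "x $ j \<le> 1" for j
      by (auto simp: unit_cube_def)
    have "x \<in> solutions w p A b \<longleftrightarrow>
      (\<forall>i. (\<forall>j. x $ j \<le> X_upper_row w p A b i $ j) \<and>
           (\<exists>j. j \<in> J_set w p A b i \<and> crit_value w p A b i j \<le> x $ j))"
      using True A b w p empty x
      by (simp add: solutions_def row_solutions_def max_power_mean_eq_iff
          power_mean_le_iff_le_upper power_mean_ge_iff_crit_le)
    also have "\<dots> \<longleftrightarrow> (\<forall>j. x $ j \<le> X_upper w p A b $ j) \<and>
      (\<forall>i. \<exists>j. j \<in> J_set w p A b i \<and> crit_value w p A b i j \<le> x $ j)"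
      by (auto simp: le_X_upper_iff)
    also have "\<dots> \<longleftrightarrow> (\<forall>j. x $ j \<le> X_upper w p A b $ j) \<and>
      (\<exists>e. \<forall>i. e i \<in> J_set w p A b i \<and> crit_value w p A b i (e i) \<le> x $ e i)"
      by (simp only: choice_iff)
    also have "\<dots> \<longleftrightarrow>
      (\<exists>e\<in>selections w p A b. (\<forall>j. X_lower w p A b e $ j \<le> x $ j) \<and>
        (\<forall>j. x $ j \<le> X_upper w p A b $ j))"
      by (auto simp: X_lower_le_iff[OF x(1)] selections_def)
    also have "\<dots> \<longleftrightarrow>
      x \<in> (\<Union>e\<in>selections w p A b. box_interval (X_lower w p A b e) (X_upper w p A b))"
      using True by (auto simp: box_interval_def)
    finally show ?thesis .
  qed
qed

end
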